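(* Consider the "identify all boxes" variant of the Test and Find problem (see context), with reward $C>0$. (i) Let $\gamma^*:\Sigma\to\Gamma$ be any function such that for each $s\in\Sigma$ $$\gamma^*(s)\in\underset{\gamma\in\Gamma}{\operatorname{argmax}}\ \pi(\gamma)\prod_{i:\gamma_i=1}a_i^{s_i}(1-a_i)^{1-s_i}\prod_{i:\gamma_i=0}b_i^{1-s_i}(1-b_i)^{s_i}.$$ Then $\gamma^*$ maximizes the expected reward $C\,P(\delta(S)=T)$ among all functions $\delta:\Sigma\to\Gamma$, and its expected reward equals $$C\sum_{s\in\Sigma}\max_{\gamma\in\Gamma}\Big(\pi(\gamma)\prod_{i:\gamma_i=1}a_i^{s_i}(1-a_i)^{1-s_i}\prod_{i:\gamma_i=0}b_i^{1-s_i}(1-b_i)^{s_i}\Big).$$ (ii) Suppose in addition that $\pi$ is the uniform distribution on $\Gamma$ and that $a_i=a$, $b_i=b$ for all $i$, where $1/2\le a,b<1$ and at least one of $a\ne1/2$, $b\neq 1/2$ holds. For $s\in\Sigma$ let $x=\sum_{i=1}^n(1-s_i)$. Then any $\gamma\in\Gamma$ with $\sum_{i=1}^n\gamma_i(1-s_i)=\max(k-n+x,0)$ attains the maximum defining $\gamma^*(s)$ in (i).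
   Context: Let $n\ge1$, $0\le k\le n$ be integers and $a_i,b_i\in[1/2,1]$ for $i=1,\dots,n$. Let $\Gamma=\{\gamma\in\{0,1\}^n:\sum_j\gamma_j=k\}$ (allocations of $k$ objects to $n$ boxes) and $\Sigma=\{0,1\}^n$ (signals). $T$ is a $\Gamma$-valued random vector with arbitrary distribution $\pi$. $S=(S_1,\dots,S_n)\in\Sigma$ is the vector of test results: conditionally on $T=\gamma$, the $S_i$ are independent with $P(S_i=1|T=\gamma)=a_i$ if $\gamma_i=1$ and $P(S_i=0|T=\gamma)=b_i$ if $\gamma_i=0$. Convention $0^0=1$. In this variant the decision maker observes $S$ and then names an allocation $\delta(S)\in\Gamma$ (tagging exactly the boxes $i$ with $\delta(S)_i=1$); she receives $C$ if $\delta(S)=T$, i.e., if all boxes are correctly identified, and $0$ otherwise. *)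

theory Defs
  imports "HOL-Probability.Probability"
begin

definition signals :: "nat \<Rightarrow> (nat \<Rightarrow> nat) set" where
  "signals n = {1..n} \<rightarrow>\<^sub>E {0, 1}"

definition allocations :: "nat \<Rightarrow> nat \<Rightarrow> (nat \<Rightarrow> nat) set" where
  "allocations n k = {\<gamma> \<in> {1..n} \<rightarrow>\<^sub>E {0, 1}. (\<Sum>j\<in>{1..n}. \<gamma> j) = k}"

(* Conditioning on {T = \<gamma>} is only meaningful when that event has positive probability.
   The conditional law given that event is the normalised restriction of M to it,
   i.e. the library's uniform_measure. *)
locale test_and_find = prob_space M
  for M :: "'w measure" +
  fixes n k :: nat
    and a b :: "nat \<Rightarrow> real"
    and \<pi> :: "(nat \<Rightarrow> nat) pmf"
    and T S :: "'w \<Rightarrow> nat \<Rightarrow> nat"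
  assumes n_ge_1: "n \<ge> 1"
    and k_le_n: "k \<le> n"
    and a_range: "\<And>i. i \<in> {1..n} \<Longrightarrow> a i \<in> {1/2..1}"
    and b_range: "\<And>i. i \<in> {1..n} \<Longrightarrow> b i \<in> {1/2..1}"
    and T_measurable: "T \<in> measurable M (count_space (allocations n k))"
    and S_measurable: "S \<in> measurable M (count_space (signals n))"
    and T_distr: "distr M (count_space UNIV) T = measure_pmf \<pi>"
    and S_cond_indep:
      "\<And>\<gamma>. \<lbrakk>\<gamma> \<in> allocations n k; pmf \<pi> \<gamma> > 0\<rbrakk> \<Longrightarrow>
        prob_space.indep_vars (uniform_measure M {\<omega> \<in> space M. T \<omega> = \<gamma>})
          (\<lambda>_. count_space {0, 1}) (\<lambda>i \<omega>. S \<omega> i) {1..n}"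
    and S_cond_prob_1:
      "\<And>\<gamma> i. \<lbrakk>\<gamma> \<in> allocations n k; pmf \<pi> \<gamma> > 0; i \<in> {1..n}; \<gamma> i = 1\<rbrakk> \<Longrightarrow>
        \<P>(\<omega> in M. S \<omega> i = 1 \<bar> T \<omega> = \<gamma>) = a i"
    and S_cond_prob_0:
      "\<And>\<gamma> i. \<lbrakk>\<gamma> \<in> allocations n k; pmf \<pi> \<gamma> > 0; i \<in> {1..n}; \<gamma> i = 0\<rbrakk> \<Longrightarrow>
        \<P>(\<omega> in M. S \<omega> i = 0 \<bar> T \<omega> = \<gamma>) = b i"

definition weight ::
  "nat \<Rightarrow> (nat \<Rightarrow> real) \<Rightarrow> (nat \<Rightarrow> real) \<Rightarrow> (nat \<Rightarrow> nat) pmf \<Rightarrow> (nat \<Rightarrow> nat) \<Rightarrow> (nat \<Rightarrow> nat) \<Rightarrow> real" where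
  "weight n a b \<pi> s \<gamma> =
     pmf \<pi> \<gamma> * (\<Prod>i | i \<in> {1..n} \<and> \<gamma> i = 1. a i ^ s i * (1 - a i) ^ (1 - s i))
            * (\<Prod>i | i \<in> {1..n} \<and> \<gamma> i = 0. b i ^ (1 - s i) * (1 - b i) ^ s i)"

definition expected_reward ::
  "'w measure \<Rightarrow> ('w \<Rightarrow> nat \<Rightarrow> nat) \<Rightarrow> ('w \<Rightarrow> nat \<Rightarrow> nat) \<Rightarrow> real \<Rightarrow> ((nat \<Rightarrow> nat) \<Rightarrow> nat \<Rightarrow> nat) \<Rightarrow> real" where
  "expected_reward M T S C \<delta> = (LINT \<omega>|M. (if \<delta> (S \<omega>) = T \<omega> then C else 0))"

lemma (in test_and_find) expected_reward_eq:
  assumes "\<delta> \<in> signals n \<rightarrow> allocations n k"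
  shows "expected_reward M T S C \<delta> = C * \<P>(\<omega> in M. \<delta> (S \<omega>) = T \<omega>)"
proof -
  have fin: "finite (signals n)" "finite (allocations n k)"
    unfolding signals_def allocations_def
    by (auto intro!: finite_PiE finite_subset[OF Collect_restrict[of "{1..n} \<rightarrow>\<^sub>E {0, 1}"]])
  have "{\<omega> \<in> space M. \<delta> (S \<omega>) = T \<omega>} =
      (\<Union>s\<in>signals n. (S -` {s} \<inter> space M) \<inter> (T -` {\<delta> s} \<inter> space M))"
    using measurable_space[OF S_measurable] by auto
  moreover have "\<dots> \<in> sets M"
    using fin assms
    by (intro sets.finite_UN sets.Int measurable_sets[OF S_measurable] measurable_sets[OF T_measurable]) auto
  ultimately have E: "{\<omega> \<in> space M. \<delta> (S \<omega>) = T \<omega>} \<in> sets M" by simp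
  have "expected_reward M T S C \<delta> =
      (LINT \<omega>|M. C * indicator {\<omega> \<in> space M. \<delta> (S \<omega>) = T \<omega>} \<omega>)"
    unfolding expected_reward_def by (intro Bochner_Integration.integral_cong) auto
  then show ?thesis using E by simp
qed

end

theory Submission imports Defs begin

text \<open>
  Part (i) is a Bayes rule computation. Conditioning on the true allocation and multiplying by its
  prior probability shows that the weight of \<open>\<gamma>\<close> at \<open>s\<close> is exactly the joint probability
  \<open>P(S = s, T = \<gamma>)\<close> (lemma \<open>prob_joint_eq_weight\<close>). Hence the success probability of a decision rule
  \<open>\<delta>\<close> is the sum over all signals \<open>s\<close> of the weight of \<open>\<delta> s\<close> at \<open>s\<close> (lemma
  \<open>expected_reward_eq_sum_weight\<close>). The terms of this sum are chosen independently of one another,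
  so the sum is largest exactly when each of its terms is.

  For part (ii), let \<open>m\<close> be the number of occupied boxes with a negative test. Since the number of
  occupied boxes and the number \<open>x\<close> of negative tests are given, \<open>m\<close> determines all four cell
  counts in the two-by-two table of contents against test results, so in the homogeneous model the
  weight depends on \<open>\<gamma>\<close> only through \<open>m\<close> (lemma \<open>weight_homogeneous\<close>). Raising \<open>m\<close> by one trades a
  correct positive and a correct negative result for a false one of each kind, which multiplies the
  weight by \<open>(1 - a) (1 - b) / (a b) \<le> 1\<close>. Small \<open>m\<close> is therefore best, and
  \<open>max (k - n + x) 0\<close> is a lower bound for \<open>m\<close>, because every cell count is nonnegative.
\<close>

section \<open>Signals and allocations\<close>

lemma finite_signals: "finite (signals n)"
  unfolding signals_def by (intro finite_PiE) auto

lemma allocations_subset_signals: "allocations n k \<subseteq> signals n"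
  unfolding allocations_def signals_def by auto

lemma finite_allocations: "finite (allocations n k)"
  using finite_subset[OF allocations_subset_signals finite_signals] .

lemma signal_cases:
  assumes "s \<in> signals n" "i \<in> {1..n}"
  obtains "s i = 0" | "s i = 1"
proof -
  have "s i \<in> {0, 1}"
    using assms unfolding signals_def by (rule PiE_mem)
  then have "s i = 0 \<or> s i = 1" by simp
  then show ?thesis using that by (elim disjE)
qed

lemma signal_eq_iff:
  assumes "s \<in> signals n" "t \<in> signals n"
  shows "s = t \<longleftrightarrow> (\<forall>i\<in>{1..n}. s i = t i)"
  using assms unfolding signals_def by (auto intro: PiE_ext)

lemma allocation_split:
  assumes "\<gamma> \<in> allocations n k"
  shows "{1..n} = {i \<in> {1..n}. \<gamma> i = 1} \<union> {i \<in> {1..n}. \<gamma> i = 0}"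
proof -
  have "\<gamma> i = 0 \<or> \<gamma> i = 1" if "i \<in> {1..n}" for i
    using signal_cases[OF subsetD[OF allocations_subset_signals assms] that] by blast
  then show ?thesis by blast
qed

section \<open>Weights are joint probabilities\<close>

text \<open>The probability that a box reports \<open>v\<close> when its content is \<open>c\<close>: \<open>a\<close> and \<open>b\<close> are the
  probabilities of a correct result for an occupied and for an empty box.\<close>
definition box_likelihood :: "real \<Rightarrow> real \<Rightarrow> nat \<Rightarrow> nat \<Rightarrow> real" where
  "box_likelihood a b c v =
     (if c = 1 then a ^ v * (1 - a) ^ (1 - v) else b ^ (1 - v) * (1 - b) ^ v)"

lemma weight_eq_prod_box_likelihood:
  assumes "\<gamma> \<in> allocations n k"
  shows "weight n a b \<pi> s \<gamma> = pmf \<pi> \<gamma> * (\<Prod>i\<in>{1..n}. box_likelihood (a i) (b i) (\<gamma> i) (s i))"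
proof -
  have "(\<Prod>i\<in>{1..n}. box_likelihood (a i) (b i) (\<gamma> i) (s i)) =
      (\<Prod>i\<in>{i \<in> {1..n}. \<gamma> i = 1} \<union> {i \<in> {1..n}. \<gamma> i = 0}. box_likelihood (a i) (b i) (\<gamma> i) (s i))"
    by (rule arg_cong[OF allocation_split[OF assms]])
  also have "\<dots> = (\<Prod>i | i \<in> {1..n} \<and> \<gamma> i = 1. box_likelihood (a i) (b i) (\<gamma> i) (s i)) *
      (\<Prod>i | i \<in> {1..n} \<and> \<gamma> i = 0. box_likelihood (a i) (b i) (\<gamma> i) (s i))"
    by (intro prod.union_disjoint) auto
  also have "\<dots> = (\<Prod>i | i \<in> {1..n} \<and> \<gamma> i = 1. a i ^ s i * (1 - a i) ^ (1 - s i)) *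
      (\<Prod>i | i \<in> {1..n} \<and> \<gamma> i = 0. b i ^ (1 - s i) * (1 - b i) ^ s i)"
    by (intro arg_cong2[of _ _ _ _ "(*)"] prod.cong) (auto simp: box_likelihood_def)
  finally show ?thesis
    unfolding weight_def by (simp add: mult.assoc)
qed

context test_and_find
begin

lemma event_T: "{\<omega> \<in> space M. T \<omega> = \<gamma>} \<in> sets M"
proof -
  have "{\<omega> \<in> space M. T \<omega> = \<gamma>} = T -` ({\<gamma>} \<inter> allocations n k) \<inter> space M"
    using measurable_space[OF T_measurable] by auto
  then show ?thesis
    using measurable_sets[OF T_measurable, of "{\<gamma>} \<inter> allocations n k"] by simp
qed

lemma prob_T: "\<P>(\<omega> in M. T \<omega> = \<gamma>) = pmf \<pi> \<gamma>"
proof -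
  have "T \<in> measurable M (count_space UNIV)"
    using measurable_compose[OF T_measurable, of "\<lambda>x. x" "count_space UNIV"] by simp
  then have "measure (distr M (count_space UNIV) T) {\<gamma>} = \<P>(\<omega> in M. T \<omega> = \<gamma>)"
    by (subst measure_distr) (auto intro!: arg_cong[where f = prob])
  then show ?thesis
    by (simp add: T_distr pmf.rep_eq)
qed

lemma S_in_signals: "\<omega> \<in> space M \<Longrightarrow> S \<omega> \<in> signals n"
  using measurable_space[OF S_measurable] by simp

lemma event_S_box:
  assumes "i \<in> {1..n}"
  shows "{\<omega> \<in> space M. S \<omega> i = v} \<in> sets M"
proof -
  have "{\<omega> \<in> space M. S \<omega> i = v} = S -` {s \<in> signals n. s i = v} \<inter> space M"
    using S_in_signals by auto
  then show ?thesis
    using measurable_sets[OF S_measurable, of "{s \<in> signals n. s i = v}"] by simp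
qed

text \<open>The model prescribes only the probability of a correct result in each box; the other
  value is the complementary event.\<close>
lemma cond_prob_S_box:
  assumes \<gamma>: "\<gamma> \<in> allocations n k" and pos: "pmf \<pi> \<gamma> > 0"
    and i: "i \<in> {1..n}" and s: "s \<in> signals n"
  shows "\<P>(\<omega> in M. S \<omega> i = s i \<bar> T \<omega> = \<gamma>) = box_likelihood (a i) (b i) (\<gamma> i) (s i)"
proof -
  have compl: "\<P>(\<omega> in M. S \<omega> i = 0 \<bar> T \<omega> = \<gamma>) + \<P>(\<omega> in M. S \<omega> i = 1 \<bar> T \<omega> = \<gamma>) = 1"
  proof -
    have sets: "{\<omega> \<in> space M. S \<omega> i = v \<and> T \<omega> = \<gamma>} \<in> sets M" for v
      using sets.Int[OF event_S_box[OF i] event_T] by (simp add: Int_def conj_commute conj_left_commute)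
    have "{\<omega> \<in> space M. T \<omega> = \<gamma>} =
        {\<omega> \<in> space M. S \<omega> i = 0 \<and> T \<omega> = \<gamma>} \<union> {\<omega> \<in> space M. S \<omega> i = 1 \<and> T \<omega> = \<gamma>}"
      using signal_cases[OF S_in_signals i] by blast
    then have "\<P>(\<omega> in M. T \<omega> = \<gamma>) =
        \<P>(\<omega> in M. S \<omega> i = 0 \<and> T \<omega> = \<gamma>) + \<P>(\<omega> in M. S \<omega> i = 1 \<and> T \<omega> = \<gamma>)"
      by (simp only:) (rule finite_measure_Union[OF sets sets], auto)
    then show ?thesis
      using pos prob_T[of \<gamma>] by (simp add: cond_prob_def flip: add_divide_distrib)
  qed
  from subsetD[OF allocations_subset_signals \<gamma>] i s show ?thesis
  proof (cases rule: signal_cases)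
    case 1
    with S_cond_prob_0[OF \<gamma> pos i] compl show ?thesis
      by (cases rule: signal_cases[OF s i]) (auto simp: box_likelihood_def)
  next
    case 2
    with S_cond_prob_1[OF \<gamma> pos i] compl show ?thesis
      by (cases rule: signal_cases[OF s i]) (auto simp: box_likelihood_def)
  qed
qed

text \<open>An allocation of prior probability zero makes both sides vanish. For any other one, the joint
  probability is the prior times the conditional probability of \<open>s\<close>, and conditional
  independence turns the latter into the product of the box likelihoods.\<close>
lemma prob_joint_eq_weight:
  assumes \<gamma>: "\<gamma> \<in> allocations n k" and s: "s \<in> signals n"
  shows "\<P>(\<omega> in M. S \<omega> = s \<and> T \<omega> = \<gamma>) = weight n a b \<pi> s \<gamma>"
proof (cases "pmf \<pi> \<gamma> > 0")
  case False
  then have null: "pmf \<pi> \<gamma> = 0"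
    using pmf_nonneg[of \<pi> \<gamma>] by linarith
  have "\<P>(\<omega> in M. S \<omega> = s \<and> T \<omega> = \<gamma>) \<le> \<P>(\<omega> in M. T \<omega> = \<gamma>)"
    by (intro finite_measure_mono event_T) auto
  with null show ?thesis
    by (simp add: prob_T weight_def measure_le_0_iff)
next
  case True
  define U where "U = uniform_measure M {\<omega> \<in> space M. T \<omega> = \<gamma>}"
  have emeasure_T: "emeasure M {\<omega> \<in> space M. T \<omega> = \<gamma>} \<noteq> 0"
    using True prob_T[of \<gamma>] by (auto simp: measure_def)
  then interpret U: prob_space U
    unfolding U_def by (intro prob_space_uniform_measure) auto
  have U_event: "U.prob {\<omega> \<in> space M. P \<omega>} = \<P>(\<omega> in M. P \<omega> \<bar> T \<omega> = \<gamma>)"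
    if "{\<omega> \<in> space M. P \<omega>} \<in> sets M" for P
    using that emeasure_T unfolding U_def
    by (subst measure_uniform_measure)
       (auto simp: cond_prob_def intro!: arg_cong2[of _ _ _ _ "(/)"] arg_cong[where f = prob])
  have all_boxes: "{\<omega> \<in> space M. S \<omega> = s} = (\<Inter>i\<in>{1..n}. {\<omega> \<in> space M. S \<omega> i = s i})"
  proof -
    have "1 \<in> {1..n}" using n_ge_1 by simp
    then have "\<omega> \<in> (\<Inter>i\<in>{1..n}. {\<omega> \<in> space M. S \<omega> i = s i}) \<longleftrightarrow>
        \<omega> \<in> space M \<and> (\<forall>i\<in>{1..n}. S \<omega> i = s i)" for \<omega>
      by blast
    then show ?thesis
      using signal_eq_iff[OF S_in_signals s] by blast
  qed
  have event_S: "{\<omega> \<in> space M. S \<omega> = s} \<in> sets M"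
    unfolding all_boxes using n_ge_1 by (intro sets.finite_INT event_S_box) auto
  have indep: "U.indep_vars (\<lambda>_. count_space {0, 1}) (\<lambda>i \<omega>. S \<omega> i) {1..n}"
    using S_cond_indep[OF \<gamma> True] by (simp add: U_def)
  have "\<P>(\<omega> in M. S \<omega> = s \<bar> T \<omega> = \<gamma>) = U.prob {\<omega> \<in> space M. S \<omega> = s}"
    using U_event[OF event_S] by simp
  also have "\<dots> = U.prob (\<Inter>i\<in>{1..n}. (\<lambda>\<omega>. S \<omega> i) -` {s i} \<inter> space U)"
    unfolding all_boxes by (intro arg_cong[where f = U.prob] INF_cong) (auto simp: U_def)
  also have "\<dots> = (\<Prod>i\<in>{1..n}. U.prob ((\<lambda>\<omega>. S \<omega> i) -` {s i} \<inter> space U))"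
    using n_ge_1 s by (intro U.indep_varsD[OF indep]) (auto simp: signals_def PiE_iff)
  also have "\<dots> = (\<Prod>i\<in>{1..n}. box_likelihood (a i) (b i) (\<gamma> i) (s i))"
  proof (intro prod.cong refl)
    fix i assume i: "i \<in> {1..n}"
    have "(\<lambda>\<omega>. S \<omega> i) -` {s i} \<inter> space U = {\<omega> \<in> space M. S \<omega> i = s i}"
      by (auto simp: U_def)
    then show "U.prob ((\<lambda>\<omega>. S \<omega> i) -` {s i} \<inter> space U) = box_likelihood (a i) (b i) (\<gamma> i) (s i)"
      using U_event[OF event_S_box[OF i]] cond_prob_S_box[OF \<gamma> True i s] by simp
  qed
  finally show ?thesis
    using True by (simp add: cond_prob_def prob_T weight_eq_prod_box_likelihood[OF \<gamma>] field_simps)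
qed

section \<open>The expected reward of a decision rule\<close>

lemma expected_reward_eq_sum_weight:
  assumes \<delta>: "\<delta> \<in> signals n \<rightarrow> allocations n k"
  shows "expected_reward M T S C \<delta> = C * (\<Sum>s\<in>signals n. weight n a b \<pi> s (\<delta> s))"
proof -
  have sets: "{\<omega> \<in> space M. S \<omega> = s \<and> T \<omega> = \<delta> s} \<in> sets M" if "s \<in> signals n" for s
  proof -
    have "{\<omega> \<in> space M. S \<omega> = s \<and> T \<omega> = \<delta> s} =
        (S -` {s} \<inter> space M) \<inter> {\<omega> \<in> space M. T \<omega> = \<delta> s}"
      by auto
    with measurable_sets[OF S_measurable, of "{s}"] that show ?thesis
      by (simp add: sets.Int event_T)
  qed
  have "{\<omega> \<in> space M. \<delta> (S \<omega>) = T \<omega>} =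
      (\<Union>s\<in>signals n. {\<omega> \<in> space M. S \<omega> = s \<and> T \<omega> = \<delta> s})"
    using S_in_signals by auto
  then have "\<P>(\<omega> in M. \<delta> (S \<omega>) = T \<omega>) =
      prob (\<Union>s\<in>signals n. {\<omega> \<in> space M. S \<omega> = s \<and> T \<omega> = \<delta> s})"
    by simp
  also have "\<dots> = (\<Sum>s\<in>signals n. \<P>(\<omega> in M. S \<omega> = s \<and> T \<omega> = \<delta> s))"
    using sets by (intro finite_measure_finite_Union finite_signals) (auto simp: disjoint_family_on_def)
  also have "\<dots> = (\<Sum>s\<in>signals n. weight n a b \<pi> s (\<delta> s))"
    using \<delta> by (intro sum.cong refl prob_joint_eq_weight) auto
  finally show ?thesis
    using expected_reward_eq[OF \<delta>] by simp
qed

end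

lemma is_arg_max_finite_iff_Max:
  fixes f :: "'a \<Rightarrow> real"
  assumes "finite A"
  shows "is_arg_max f (\<lambda>x. x \<in> A) x \<longleftrightarrow> x \<in> A \<and> f x = Max (f ` A)"
  using assms by (auto simp: is_arg_max_linorder intro!: Max_eqI[symmetric])

section \<open>The homogeneous model\<close>

text \<open>The contents of the boxes and the test results form a two-by-two table whose margins are
  fixed, so that \<open>m\<close> determines every cell count. The three inequalities say that the natural
  number differences in the exponents do not truncate.\<close>
lemma weight_homogeneous:
  fixes a0 b0 :: real
  assumes ab: "\<forall>i\<in>{1..n}. a i = a0 \<and> b i = b0"
    and s: "s \<in> signals n" and \<gamma>: "\<gamma> \<in> allocations n k"
    and x: "x = (\<Sum>i\<in>{1..n}. 1 - s i)" and m: "m = (\<Sum>i\<in>{1..n}. \<gamma> i * (1 - s i))"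
  shows "m \<le> k" "m \<le> x" "k + x \<le> n + m"
    "weight n a b \<pi> s \<gamma> =
       pmf \<pi> \<gamma> * (a0 ^ (k - m) * (1 - a0) ^ m) * (b0 ^ (x - m) * (1 - b0) ^ (n + m - (k + x)))"
proof -
  define O1 where "O1 = {i \<in> {1..n}. \<gamma> i = 1}"
  define O0 where "O0 = {i \<in> {1..n}. \<gamma> i = 0}"
  have fin: "finite O1" "finite O0" and disj: "O1 \<inter> O0 = {}"
    by (auto simp: O1_def O0_def)
  have un: "{1..n} = O1 \<union> O0"
    unfolding O1_def O0_def by (rule allocation_split[OF \<gamma>])
  have split: "(\<Sum>i\<in>{1..n}. f i) = (\<Sum>i\<in>O1. f i) + (\<Sum>i\<in>O0. f i)" for f :: "nat \<Rightarrow> nat"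
    unfolding un using fin disj by (rule sum.union_disjoint)
  have sum_compl: "(\<Sum>i\<in>A. s i) + (\<Sum>i\<in>A. 1 - s i) = card A" if A: "A \<subseteq> {1..n}" for A
  proof -
    have "s i + (1 - s i) = 1" if "i \<in> A" for i
      by (rule signal_cases[OF s subsetD[OF A that]]) simp_all
    then show ?thesis
      by (simp flip: sum.distrib)
  qed
  have \<gamma>_O1: "\<gamma> i = 1" if "i \<in> O1" for i using that by (simp add: O1_def)
  have \<gamma>_O0: "\<gamma> i = 0" if "i \<in> O0" for i using that by (simp add: O0_def)
  have card_O1: "card O1 = k"
    using \<gamma> split[of \<gamma>] by (simp add: allocations_def \<gamma>_O1 \<gamma>_O0)
  have card_O0: "k + card O0 = n"
    using card_Un_disjoint[OF fin disj] card_O1 by (simp flip: un)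
  have m_O1: "m = (\<Sum>i\<in>O1. 1 - s i)"
    using split[of "\<lambda>i. \<gamma> i * (1 - s i)"] m by (simp add: \<gamma>_O1 \<gamma>_O0)
  have x_split: "x = m + (\<Sum>i\<in>O0. 1 - s i)"
    using split[of "\<lambda>i. 1 - s i"] x m_O1 by simp
  have s_O1: "(\<Sum>i\<in>O1. s i) + m = k"
    using sum_compl[of O1] un card_O1 m_O1 by simp
  have s_O0: "k + x + (\<Sum>i\<in>O0. s i) = n + m"
    using sum_compl[of O0] un card_O0 x_split by simp
  show "m \<le> k" "m \<le> x" "k + x \<le> n + m"
    using s_O1 x_split s_O0 by auto
  have "(\<Prod>i | i \<in> {1..n} \<and> \<gamma> i = 1. a i ^ s i * (1 - a i) ^ (1 - s i)) =
      (\<Prod>i\<in>O1. a0 ^ s i * (1 - a0) ^ (1 - s i))"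
    by (intro prod.cong) (use ab in \<open>auto simp: O1_def\<close>)
  also have "\<dots> = a0 ^ (\<Sum>i\<in>O1. s i) * (1 - a0) ^ (\<Sum>i\<in>O1. 1 - s i)"
    by (simp add: prod.distrib power_sum)
  also have "\<dots> = a0 ^ (k - m) * (1 - a0) ^ m"
    using s_O1 m_O1 by (metis add_diff_cancel_right')
  finally have occupied: "(\<Prod>i | i \<in> {1..n} \<and> \<gamma> i = 1. a i ^ s i * (1 - a i) ^ (1 - s i)) =
      a0 ^ (k - m) * (1 - a0) ^ m" .
  have "(\<Prod>i | i \<in> {1..n} \<and> \<gamma> i = 0. b i ^ (1 - s i) * (1 - b i) ^ s i) =
      (\<Prod>i\<in>O0. b0 ^ (1 - s i) * (1 - b0) ^ s i)"
    by (intro prod.cong) (use ab in \<open>auto simp: O0_def\<close>)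
  also have "\<dots> = b0 ^ (\<Sum>i\<in>O0. 1 - s i) * (1 - b0) ^ (\<Sum>i\<in>O0. s i)"
    by (simp add: prod.distrib power_sum)
  also have "\<dots> = b0 ^ (x - m) * (1 - b0) ^ (n + m - (k + x))"
    using x_split s_O0 by (metis add_diff_cancel_left')
  finally show "weight n a b \<pi> s \<gamma> =
      pmf \<pi> \<gamma> * (a0 ^ (k - m) * (1 - a0) ^ m) * (b0 ^ (x - m) * (1 - b0) ^ (n + m - (k + x)))"
    unfolding weight_def using occupied by simp
qed

text \<open>Both sides share a factor with \<open>k - m\<close> true positives, \<open>l\<close> false negatives, \<open>x - m\<close> true
  negatives and \<open>n + l - (k + x)\<close> false positives. The remaining \<open>m - l\<close> pairs of results are
  correct on the right and wrong on the left.\<close>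
lemma homogeneous_likelihood_antimono:
  fixes a0 b0 :: real
  assumes a0: "1/2 \<le> a0" "a0 \<le> 1" and b0: "1/2 \<le> b0" "b0 \<le> 1"
    and lm: "l \<le> m" and bounds: "m \<le> k" "m \<le> x" "k + x \<le> n + l"
  shows "(a0 ^ (k - m) * (1 - a0) ^ m) * (b0 ^ (x - m) * (1 - b0) ^ (n + m - (k + x)))
    \<le> (a0 ^ (k - l) * (1 - a0) ^ l) * (b0 ^ (x - l) * (1 - b0) ^ (n + l - (k + x)))"
proof -
  define d where "d = m - l"
  define R where "R = (a0 ^ (k - m) * (1 - a0) ^ l) * (b0 ^ (x - m) * (1 - b0) ^ (n + l - (k + x)))"
  have exps: "m = l + d" "k - l = (k - m) + d" "x - l = (x - m) + d"
    "n + m - (k + x) = (n + l - (k + x)) + d"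
    using lm bounds by (auto simp: d_def)
  have "((1 - a0) * (1 - b0)) ^ d \<le> (a0 * b0) ^ d"
    using a0 b0 by (intro power_mono mult_mono mult_nonneg_nonneg) auto
  moreover have "R \<ge> 0"
    unfolding R_def using a0 b0 by (intro mult_nonneg_nonneg zero_le_power) auto
  ultimately have "R * ((1 - a0) * (1 - b0)) ^ d \<le> R * (a0 * b0) ^ d"
    by (rule mult_left_mono)
  moreover have "(a0 ^ (k - m) * (1 - a0) ^ m) * (b0 ^ (x - m) * (1 - b0) ^ (n + m - (k + x)))
      = R * ((1 - a0) * (1 - b0)) ^ d"
  proof -
    have "(1 - a0) ^ m = (1 - a0) ^ l * (1 - a0) ^ d"
      using exps(1) by (simp add: power_add)
    then show ?thesis
      unfolding R_def exps(4) power_add power_mult_distrib by (simp only: mult_ac)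
  qed
  moreover have "(a0 ^ (k - l) * (1 - a0) ^ l) * (b0 ^ (x - l) * (1 - b0) ^ (n + l - (k + x)))
      = R * (a0 * b0) ^ d"
    unfolding R_def exps(2,3) power_add power_mult_distrib by (simp only: mult_ac)
  ultimately show ?thesis by simp
qed

text \<open>The bound \<open>k + x \<le> n + m\<close>, nonnegativity of the number of empty boxes with a positive test,
  shows that no allocation has a smaller \<open>m\<close> than the given one. The uniform prior then
  cancels from the comparison of weights.\<close>
lemma is_arg_max_weight_uniform:
  fixes a0 b0 :: real
  assumes \<pi>: "\<pi> = pmf_of_set (allocations n k)"
    and ab: "\<forall>i\<in>{1..n}. a i = a0 \<and> b i = b0"
    and a0: "1/2 \<le> a0" "a0 \<le> 1" and b0: "1/2 \<le> b0" "b0 \<le> 1"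
    and s: "s \<in> signals n" and x: "x = (\<Sum>i\<in>{1..n}. 1 - s i)" and \<gamma>: "\<gamma> \<in> allocations n k"
    and least: "int (\<Sum>i\<in>{1..n}. \<gamma> i * (1 - s i)) = max (int k - int n + int x) 0"
  shows "is_arg_max (weight n a b \<pi> s) (\<lambda>\<gamma>. \<gamma> \<in> allocations n k) \<gamma>"
proof -
  define l where "l = (\<Sum>i\<in>{1..n}. \<gamma> i * (1 - s i))"
  have "weight n a b \<pi> s \<gamma>' \<le> weight n a b \<pi> s \<gamma>" if \<gamma>': "\<gamma>' \<in> allocations n k" for \<gamma>'
  proof -
    define m where "m = (\<Sum>i\<in>{1..n}. \<gamma>' i * (1 - s i))"
    note W = weight_homogeneous[OF ab s \<gamma> x l_def]
    note W' = weight_homogeneous[OF ab s \<gamma>' x m_def]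
    have "l \<le> m"
      using least W'(3) unfolding l_def[symmetric] by linarith
    moreover have "pmf \<pi> \<gamma>' = pmf \<pi> \<gamma>"
    proof -
      have "allocations n k \<noteq> {}"
        using \<gamma> by blast
      then show ?thesis
        using \<gamma> \<gamma>' unfolding \<pi> by (simp add: finite_allocations)
    qed
    ultimately show ?thesis
      unfolding W(4) W'(4) mult.assoc[of "pmf _ _"]
      by (simp only:) (intro mult_left_mono pmf_nonneg
            homogeneous_likelihood_antimono[OF a0 b0 _ W'(1,2) W(3)])
  qed
  with \<gamma> show ?thesis
    by (simp add: is_arg_max_linorder)
qed

section \<open>Optimal identification of all boxes\<close>

theorem mainTheorem5:
  fixes M :: "'w measure" and n k :: nat and a b :: "nat \<Rightarrow> real"
    and \<pi> :: "(nat \<Rightarrow> nat) pmf" and T S :: "'w \<Rightarrow> nat \<Rightarrow> nat" and C :: real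
  assumes model: "test_and_find M n k a b \<pi> T S"
    and C_pos: "C > 0"
  shows
    "(\<forall>\<gamma>star \<in> signals n \<rightarrow> allocations n k.
        (\<forall>s \<in> signals n. is_arg_max (weight n a b \<pi> s) (\<lambda>\<gamma>. \<gamma> \<in> allocations n k) (\<gamma>star s)) \<longrightarrow>
        is_arg_max (expected_reward M T S C) (\<lambda>\<delta>. \<delta> \<in> signals n \<rightarrow> allocations n k) \<gamma>star \<and>
        expected_reward M T S C \<gamma>star =
          C * (\<Sum>s \<in> signals n. Max (weight n a b \<pi> s ` allocations n k)))
     \<and>
     (\<forall>a0 b0 :: real.
        \<pi> = pmf_of_set (allocations n k) \<and>
        (\<forall>i \<in> {1..n}. a i = a0 \<and> b i = b0) \<and>
        1/2 \<le> a0 \<and> a0 < 1 \<and> 1/2 \<le> b0 \<and> b0 < 1 \<and>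
        (a0 \<noteq> 1/2 \<or> b0 \<noteq> 1/2) \<longrightarrow>
        (\<forall>s \<in> signals n. \<forall>x :: nat. x = (\<Sum>i\<in>{1..n}. 1 - s i) \<longrightarrow>
          (\<forall>\<gamma> \<in> allocations n k.
            int (\<Sum>i\<in>{1..n}. \<gamma> i * (1 - s i)) = max (int k - int n + int x) 0 \<longrightarrow>
            is_arg_max (weight n a b \<pi> s) (\<lambda>\<gamma>. \<gamma> \<in> allocations n k) \<gamma>)))"
proof -
  interpret test_and_find M n k a b \<pi> T S by (rule model)
  let ?w = "weight n a b \<pi>" and ?R = "expected_reward M T S C"
    and ?D = "signals n \<rightarrow> allocations n k"
  show ?thesis
  proof (intro conjI ballI allI impI)
    fix \<gamma>star
    assume star: "\<gamma>star \<in> ?D"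
      and opt: "\<forall>s \<in> signals n. is_arg_max (?w s) (\<lambda>\<gamma>. \<gamma> \<in> allocations n k) (\<gamma>star s)"
    show "is_arg_max ?R (\<lambda>\<delta>. \<delta> \<in> ?D) \<gamma>star"
      unfolding is_arg_max_linorder
    proof (intro conjI allI impI star)
      fix \<delta> assume \<delta>: "\<delta> \<in> ?D"
      have "(\<Sum>s\<in>signals n. ?w s (\<delta> s)) \<le> (\<Sum>s\<in>signals n. ?w s (\<gamma>star s))"
        using opt \<delta> by (intro sum_mono) (auto simp: is_arg_max_linorder)
      then show "?R \<delta> \<le> ?R \<gamma>star"
        using C_pos by (simp add: expected_reward_eq_sum_weight \<delta> star)
    qed
    show "?R \<gamma>star = C * (\<Sum>s \<in> signals n. Max (?w s ` allocations n k))"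
      using opt by (simp add: expected_reward_eq_sum_weight[OF star]
          is_arg_max_finite_iff_Max[OF finite_allocations])
  next
    fix a0 b0 :: real and s x \<gamma>
    assume hom: "\<pi> = pmf_of_set (allocations n k) \<and> (\<forall>i \<in> {1..n}. a i = a0 \<and> b i = b0) \<and>
        1/2 \<le> a0 \<and> a0 < 1 \<and> 1/2 \<le> b0 \<and> b0 < 1 \<and> (a0 \<noteq> 1/2 \<or> b0 \<noteq> 1/2)"
      and s: "s \<in> signals n" and x: "x = (\<Sum>i\<in>{1..n}. 1 - s i)"
      and \<gamma>: "\<gamma> \<in> allocations n k"
      and least: "int (\<Sum>i\<in>{1..n}. \<gamma> i * (1 - s i)) = max (int k - int n + int x) 0"
    have \<pi>: "\<pi> = pmf_of_set (allocations n k)" and ab: "\<forall>i \<in> {1..n}. a i = a0 \<and> b i = b0"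
      and bounds: "1/2 \<le> a0" "a0 \<le> 1" "1/2 \<le> b0" "b0 \<le> 1"
      using hom by (blast, blast, linarith+)
    show "is_arg_max (?w s) (\<lambda>\<gamma>. \<gamma> \<in> allocations n k) \<gamma>"
      by (rule is_arg_max_weight_uniform[OF \<pi> ab bounds s x \<gamma> least])
  qed
qed

end
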